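(* Let $G=(C,I,E)$ be a connected split graph such that some vertex of $I$ has degree at least $2$ (i.e., $G$ with this partition is not a block-split graph). Then $G$ does not admit a HIST if and only if at least one of the following holds: 1. For every $u\in C$, $|N(u)\cap I|=1$, and $|C|-|I|=1$. 2. Letting $U=\{u\in C : |N(u)\cap I|=2\}$, all of the following hold: (a) for every $u\in C$, $|N(u)\cap I|\in\{1,2\}$, and $|U|\ge 2$; (b) the sets $N(u)\cap I$, for $u\in U$, are pairwise distinct; (c) for each $u\in C\setminus U$, the unique vertex of $N(u)\cap I$ is a pendant vertex (has degree $1$ in $G$); (d) $\left|\bigcap_{u\in U}(N(u)\cap I)\right|=1$.
   Context: All graphs are finite, simple and undirected; $N(u)$ denotes the set of neighbours of $u$ in $G$. A HIST (homeomorphically irreducible spanning tree) of a connected graph $G$ is a spanning tree of $G$ with no vertex of degree exactly $2$ in the tree. A split graph $G=(C,I,E)$ is a graph whose vertex set is partitioned into a clique $C$ and an independent set $I$. A block-split graph is a split graph in which every vertex of $I$ has degree at most one. A pendant vertex is a vertex of degree $1$. *)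

theory Defs
  imports Main "HOL-Library.Ramsey"
begin

text \<open>
  A graph is given by its vertex set \<open>V\<close> and its set \<open>E\<close> of edges, each edge being a
  two-element set of vertices. The predicates \<open>clique\<close> and \<open>indep\<close> come from the
  Ramsey theory of the library and use the same representation.
\<close>

definition simple_graph :: "'a set \<Rightarrow> 'a set set \<Rightarrow> bool" where
  "simple_graph V E \<longleftrightarrow> finite V \<and> E \<subseteq> [V]\<^bsup>2\<^esup>"

definition neighbours :: "'a set set \<Rightarrow> 'a \<Rightarrow> 'a set" where
  "neighbours E u = {v. {u, v} \<in> E}"

definition vertex_degree :: "'a set set \<Rightarrow> 'a \<Rightarrow> nat" where
  "vertex_degree E u = card (neighbours E u)"

definition pendant :: "'a set set \<Rightarrow> 'a \<Rightarrow> bool" where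
  "pendant E v \<longleftrightarrow> vertex_degree E v = 1"

definition connected_graph :: "'a set \<Rightarrow> 'a set set \<Rightarrow> bool" where
  "connected_graph V E \<longleftrightarrow>
     simple_graph V E \<and> V \<noteq> {} \<and> (\<forall>u\<in>V. \<forall>v\<in>V. (u, v) \<in> {(x, y). {x, y} \<in> E}\<^sup>*)"

text \<open>A cycle is given by the list of its vertices, the first of which is not repeated at the end.\<close>

definition is_cycle :: "'a set set \<Rightarrow> 'a list \<Rightarrow> bool" where
  "is_cycle E p \<longleftrightarrow>
     length p \<ge> 3 \<and> distinct p \<and>
     (\<forall>i<length p. {p ! i, p ! (Suc i mod length p)} \<in> E)"

definition tree :: "'a set \<Rightarrow> 'a set set \<Rightarrow> bool" where
  "tree V T \<longleftrightarrow> connected_graph V T \<and> (\<nexists>p. is_cycle T p)"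

definition spanning_tree :: "'a set \<Rightarrow> 'a set set \<Rightarrow> 'a set set \<Rightarrow> bool" where
  "spanning_tree V E T \<longleftrightarrow> T \<subseteq> E \<and> tree V T"

definition HIST :: "'a set \<Rightarrow> 'a set set \<Rightarrow> 'a set set \<Rightarrow> bool" where
  "HIST V E T \<longleftrightarrow> spanning_tree V E T \<and> (\<forall>v\<in>V. vertex_degree T v \<noteq> 2)"

definition split_graph :: "'a set \<Rightarrow> 'a set \<Rightarrow> 'a set set \<Rightarrow> bool" where
  "split_graph C I E \<longleftrightarrow>
     simple_graph (C \<union> I) E \<and> C \<inter> I = {} \<and> clique C E \<and> indep I E"

end

theory Submission
  imports Defs
begin

text \<open>
  Look for a HIST in which every vertex of \<open>I\<close> is a leaf: choose a neighbour \<open>f i\<close> for each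
  \<open>i \<in> I\<close>, and call the number of \<open>i\<close> with \<open>f i = u\<close> the load of \<open>u \<in> C\<close>. If two vertices have
  loads different from 1, join them by a path through all vertices of load 1 and hang the
  remaining vertices of \<open>C\<close> on it; this gives a HIST. If instead every choice leaves at most one
  vertex with load different from 1, then moving a single \<open>i \<in> I\<close> to another neighbour, and comparing
  the loads before and after, shows that only one vertex of \<open>I\<close> has several neighbours, which
  leads to the two exceptional families.

  Conversely, a neighbour of a leaf has degree at least 3 in a HIST. In the exceptional families
  so many vertices of \<open>C\<close> have a leaf neighbour that the degree sum exceeds
  \<open>2 * card V - 2\<close>.
\<close>

section \<open>Trees\<close>

lemma neighbours_iff: "v \<in> neighbours E u \<longleftrightarrow> {u, v} \<in> E"
  by (simp add: neighbours_def)

lemma neighbours_sym: "v \<in> neighbours E u \<longleftrightarrow> u \<in> neighbours E v"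
  by (simp add: neighbours_def insert_commute)

lemma neighbours_mono: "T \<subseteq> E \<Longrightarrow> neighbours T u \<subseteq> neighbours E u"
  by (auto simp: neighbours_def)

lemma simple_graph_edge:
  assumes "simple_graph V T" "{u, v} \<in> T"
  shows "u \<in> V" "v \<in> V" "u \<noteq> v"
proof -
  have "{u, v} \<in> [V]\<^bsup>2\<^esup>"
    using assms unfolding simple_graph_def by blast
  then have "u \<in> V \<and> v \<in> V \<and> u \<noteq> v"
    using doubleton_in_nsets_2[of u v V] by blast
  then show "u \<in> V" "v \<in> V" "u \<noteq> v"
    by auto
qed

lemma neighbours_subset: "simple_graph V T \<Longrightarrow> neighbours T u \<subseteq> V - {u}"
  using simple_graph_edge(2,3)[of V T u] by (force simp: neighbours_def)

lemma finite_neighbours: "simple_graph V T \<Longrightarrow> finite (neighbours T u)"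
  using neighbours_subset[of V T u] finite_subset[of _ "V - {u}"] by (simp add: simple_graph_def)

lemma simple_graph_edge_cases:
  assumes "simple_graph V T" "e \<in> T"
  obtains u v where "e = {u, v}" "u \<in> V" "v \<in> V" "u \<noteq> v"
proof -
  have "e \<in> [V]\<^bsup>2\<^esup>"
    using assms unfolding simple_graph_def by blast
  then show thesis
    using that by (auto elim: nsets2_E)
qed

lemma sym_adjacency: "sym {(x, y). {x, y} \<in> T}"
  by (simp add: sym_def insert_commute)

lemma connected_graphI:
  assumes "simple_graph V T" "r \<in> V" "\<And>x. x \<in> V \<Longrightarrow> (r, x) \<in> {(x, y). {x, y} \<in> T}\<^sup>*"
  shows "connected_graph V T"
proof -
  have "(u, v) \<in> {(x, y). {x, y} \<in> T}\<^sup>*" if "u \<in> V" "v \<in> V" for u v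
  proof -
    have "(u, r) \<in> {(x, y). {x, y} \<in> T}\<^sup>*"
      using assms(3)[OF that(1)] by (rule symD[OF sym_rtrancl[OF sym_adjacency]])
    then show ?thesis
      using assms(3)[OF that(2)] by (rule rtrancl_trans)
  qed
  then show ?thesis
    using assms by (auto simp: connected_graph_def)
qed

lemma connected_graph_vertex_degree_pos:
  assumes "connected_graph V T" "u \<in> V" "v \<in> V" "u \<noteq> v"
  shows "vertex_degree T u \<ge> 1"
proof -
  have "(u, v) \<in> {(x, y). {x, y} \<in> T}\<^sup>*"
    using assms by (auto simp: connected_graph_def)
  then obtain x where "{u, x} \<in> T"
    using \<open>u \<noteq> v\<close> by (auto elim: converse_rtranclE)
  then have "neighbours T u \<noteq> {}"
    by (auto simp: neighbours_def)
  then show ?thesis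
    using finite_neighbours[of V T u] assms(1)
    by (simp add: vertex_degree_def connected_graph_def Suc_le_eq card_gt_0_iff)
qed

text \<open>Were \<open>b\<close> the only neighbour of \<open>u\<close>, the set
  \<open>{u, b}\<close> would be closed under adjacency, and connectedness would leave no third
  vertex.\<close>

lemma connected_graph_leaf_neighbour:
  assumes conn: "connected_graph V T" and big: "card V \<ge> 3"
    and edge: "{u, b} \<in> T" and leaf: "vertex_degree T b = 1"
  shows "vertex_degree T u \<ge> 2"
proof (rule ccontr)
  assume "\<not> ?thesis"
  have simple: "simple_graph V T"
    using conn by (simp add: connected_graph_def)
  have bu: "b \<in> neighbours T u" "u \<in> neighbours T b"
    using edge by (auto simp: neighbours_def insert_commute)
  then have "vertex_degree T u \<noteq> 0"
    using finite_neighbours[OF simple] by (auto simp: vertex_degree_def)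
  with \<open>\<not> ?thesis\<close> have "card (neighbours T u) = 1"
    by (simp add: vertex_degree_def)
  then have u: "neighbours T u = {b}"
    using bu(1) by (auto simp: card_1_singleton_iff)
  have b: "neighbours T b = {u}"
    using bu(2) leaf by (auto simp: card_1_singleton_iff vertex_degree_def)
  have "x \<in> {u, b}" if "x \<in> V" for x
  proof -
    have "(u, x) \<in> {(x, y). {x, y} \<in> T}\<^sup>*"
      using conn that simple_graph_edge[OF simple edge] by (auto simp: connected_graph_def)
    then show ?thesis
    proof induction
      case (step y z)
      then have "z \<in> neighbours T y"
        by (auto simp: neighbours_def)
      then show ?case
        using step u b by auto
    qed simp
  qed
  then have "card V \<le> card {u, b}"
    by (intro card_mono) auto
  also have "\<dots> \<le> 2"
    by (simp add: card_insert_if)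
  finally show False
    using big by simp
qed

section \<open>Cycles and the degree sum of acyclic graphs\<close>

lemma is_cycle_mono: "is_cycle S p \<Longrightarrow> S \<subseteq> T \<Longrightarrow> is_cycle T p"
  unfolding is_cycle_def by blast

text \<open>The two neighbours are the predecessor and the successor of \<open>v\<close> on the
  cycle; they differ because the length is at least 3.\<close>

lemma is_cycle_two_neighbours:
  assumes "is_cycle T p" "v \<in> set p"
  obtains x y where "x \<noteq> y" "x \<in> neighbours T v" "y \<in> neighbours T v"
proof -
  let ?n = "length p"
  from assms have n: "?n \<ge> 3" and d: "distinct p"
    and edge: "\<And>i. i < ?n \<Longrightarrow> {p ! i, p ! (Suc i mod ?n)} \<in> T"
    by (auto simp: is_cycle_def)
  from assms(2) obtain i where i: "i < ?n" "p ! i = v"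
    by (auto simp: in_set_conv_nth)
  define s where "s = (if Suc i = ?n then 0 else Suc i)"
  define r where "r = (if i = 0 then ?n - 1 else i - 1)"
  have s: "Suc i mod ?n = s" and r: "r < ?n" "Suc r mod ?n = i" and "s < ?n" "r \<noteq> s"
    using i n by (auto simp: s_def r_def)
  have "p ! r \<noteq> p ! s"
    using d \<open>r < ?n\<close> \<open>s < ?n\<close> \<open>r \<noteq> s\<close> by (simp add: nth_eq_iff_index_eq)
  moreover have "p ! s \<in> neighbours T v" "p ! r \<in> neighbours T v"
    using edge[OF i(1)] edge[OF r(1)] s r i by (auto simp: neighbours_def insert_commute)
  ultimately show thesis
    using that by blast
qed

text \<open>All neighbours of the first vertex of a longest path lie on that path, and a neighbour
  other than the second vertex would close a cycle.\<close>

lemma acyclic_vertex_degree_le_1: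
  assumes simple: "simple_graph V T" and "V \<noteq> {}" and acyclic: "\<nexists>p. is_cycle T p"
  obtains x where "x \<in> V" "vertex_degree T x \<le> 1"
proof (rule ccontr)
  assume "\<not> thesis"
  then have deg: "\<And>x. x \<in> V \<Longrightarrow> vertex_degree T x \<ge> 2"
    using that by force
  define path where "path p \<longleftrightarrow> p \<noteq> [] \<and> distinct p \<and> set p \<subseteq> V \<and>
    (\<forall>i. Suc i < length p \<longrightarrow> {p ! i, p ! Suc i} \<in> T)" for p
  have fin: "finite V"
    using simple by (simp add: simple_graph_def)
  from \<open>V \<noteq> {}\<close> obtain v where "v \<in> V" by blast
  then have "path [v]"
    by (simp add: path_def)
  moreover have "\<forall>p. path p \<longrightarrow> length p < Suc (card V)"
    using fin by (metis path_def card_mono distinct_card less_Suc_eq_le)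
  ultimately obtain p where p: "path p" and max: "\<And>q. path q \<Longrightarrow> length q \<le> length p"
    using ex_has_greatest_nat[of path "[v]" length] by (metis less_imp_le)
  define x where "x = p ! 0"
  have "x \<in> V"
    using p by (auto simp: path_def x_def)
  have inp: "y \<in> set p" if "y \<in> neighbours T x" for y
  proof (rule ccontr)
    assume "y \<notin> set p"
    have "{y, x} \<in> T"
      using that by (simp add: neighbours_def insert_commute)
    then have "path (y # p)"
      using p \<open>y \<notin> set p\<close> simple_graph_edge[OF simple]
      by (auto simp: path_def x_def nth_Cons split: nat.split)
    from max[OF this] show False by simp
  qed
  \<comment> \<open>Should \<open>p\<close> have only one vertex, \<open>p ! 1\<close> is an
    unspecified value. This is harmless: the argument only uses that \<open>{p ! 1}\<close> has one
    element and that \<open>y\<close> lies outside it.\<close>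
  have "\<not> neighbours T x \<subseteq> {p ! 1}"
  proof
    assume "neighbours T x \<subseteq> {p ! 1}"
    then have "card (neighbours T x) \<le> card {p ! 1}"
      by (intro card_mono) auto
    then show False
      using deg[OF \<open>x \<in> V\<close>] by (simp add: vertex_degree_def)
  qed
  then obtain y where y: "y \<in> neighbours T x" "y \<noteq> p ! 1"
    by blast
  with inp obtain j where j: "j < length p" "p ! j = y"
    by (metis in_set_conv_nth)
  have "y \<noteq> x"
    using y(1) neighbours_subset[OF simple] by blast
  then have "j \<ge> 2"
    using j y(2) by (cases j; cases "j - 1") (auto simp: x_def)
  have "is_cycle T (take (Suc j) p)"
    unfolding is_cycle_def
  proof (intro conjI allI impI)
    show "3 \<le> length (take (Suc j) p)" "distinct (take (Suc j) p)"
      using j p \<open>j \<ge> 2\<close> by (auto simp: path_def)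
    fix i assume i: "i < length (take (Suc j) p)"
    have closing: "{y, x} \<in> T"
      using y(1) by (simp add: neighbours_def insert_commute)
    have len: "length (take (Suc j) p) = Suc j"
      using j by simp
    show "{take (Suc j) p ! i, take (Suc j) p ! (Suc i mod length (take (Suc j) p))} \<in> T"
    proof (cases "i = j")
      case True
      then show ?thesis
        unfolding len using closing j by (simp add: x_def)
    next
      case False
      then have "Suc i < Suc j"
        using i len by simp
      then show ?thesis
        unfolding len using p j by (simp add: path_def)
    qed
  qed
  with acyclic show False by blast
qed

text \<open>Deleting a vertex of degree at most 1 lowers the degree sum by at most 2, once for the
  vertex and once for its neighbour. With an inequality over acyclic graphs, the induction does not
  have to carry connectedness along.\<close>

lemma acyclic_sum_vertex_degree:
  assumes "simple_graph V T" "V \<noteq> {}" "\<nexists>p. is_cycle T p"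
  shows "(\<Sum>v\<in>V. vertex_degree T v) + 2 \<le> 2 * card V"
  using assms
proof (induction "card V" arbitrary: V T)
  case 0
  then show ?case by (simp add: simple_graph_def)
next
  case (Suc n)
  have fin: "finite V"
    using Suc.prems by (simp add: simple_graph_def)
  obtain x where x: "x \<in> V" "vertex_degree T x \<le> 1"
    using acyclic_vertex_degree_le_1[OF Suc.prems] .
  define W where "W = V - {x}"
  define S where "S = {e \<in> T. x \<notin> e}"
  have V: "V = insert x W" "x \<notin> W" and finW: "finite W"
    using x fin by (auto simp: W_def)
  have simple: "simple_graph W S"
    unfolding simple_graph_def
  proof (intro conjI subsetI finW)
    fix e assume "e \<in> S"
    then obtain u v where "e = {u, v}" "u \<in> V" "v \<in> V" "u \<noteq> v" "x \<notin> e"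
      using simple_graph_edge_cases[OF Suc.prems(1)] by (metis (lifting) S_def mem_Collect_eq)
    then show "e \<in> [W]\<^bsup>2\<^esup>"
      by (auto simp: W_def)
  qed
  show ?case
  proof (cases "W = {}")
    case True
    then have "neighbours T x = {}"
      using neighbours_subset[OF Suc.prems(1)] V by auto
    then show ?thesis
      using V True by (simp add: vertex_degree_def)
  next
    case False
    have "n = card W"
      using Suc.hyps(2) V finW by simp
    moreover have "\<nexists>p. is_cycle S p"
      using Suc.prems(3) is_cycle_mono[of S _ T] by (auto simp: S_def)
    ultimately have IH: "(\<Sum>v\<in>W. vertex_degree S v) + 2 \<le> 2 * card W"
      using Suc.hyps(1) simple False by blast
    have "vertex_degree T v \<le> vertex_degree S v + (if v \<in> neighbours T x then 1 else 0)"
      if "v \<in> W" for v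
    proof -
      have "neighbours T v \<subseteq> neighbours S v \<union> (if v \<in> neighbours T x then {x} else {})"
        using that V by (auto simp: neighbours_def S_def insert_commute)
      then have "card (neighbours T v)
          \<le> card (neighbours S v \<union> (if v \<in> neighbours T x then {x} else {}))"
        by (intro card_mono) (auto simp: finite_neighbours[OF simple])
      also have "\<dots> \<le> card (neighbours S v) + card (if v \<in> neighbours T x then {x} else {})"
        by (rule card_Un_le)
      finally show ?thesis
        by (simp add: vertex_degree_def split: if_splits)
    qed
    then have "(\<Sum>v\<in>W. vertex_degree T v)
        \<le> (\<Sum>v\<in>W. vertex_degree S v + (if v \<in> neighbours T x then 1 else 0))"
      by (rule sum_mono)
    also have "\<dots> = (\<Sum>v\<in>W. vertex_degree S v) + card (W \<inter> neighbours T x)"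
      using finW by (simp add: sum.distrib sum.If_cases)
    also have "card (W \<inter> neighbours T x) \<le> card (neighbours T x)"
      by (intro card_mono finite_neighbours[OF Suc.prems(1)]) auto
    finally show ?thesis
      using IH x(2) V finW by (simp add: vertex_degree_def)
  qed
qed

section \<open>Building trees by attaching leaves\<close>

lemma tree_singleton: "tree {a} {}"
proof -
  have "\<not> is_cycle {} p" for p :: "'a list"
    by (cases p) (auto simp: is_cycle_def)
  then show ?thesis
    by (simp add: tree_def connected_graph_def simple_graph_def)
qed

text \<open>A cycle through the new vertex \<open>v\<close> would give it two neighbours, but it has
  only \<open>u\<close>; a cycle that avoids \<open>v\<close> already lies in
  \<open>T\<close>.\<close>

lemma tree_attach_leaf:
  assumes "tree V T" "u \<in> V" "v \<notin> V"
  shows "tree (insert v V) (insert {u, v} T)"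
proof -
  let ?T = "insert {u, v} T"
  have simple: "simple_graph V T" and conn: "connected_graph V T"
    using assms by (auto simp: tree_def connected_graph_def)
  have "connected_graph (insert v V) ?T"
  proof (rule connected_graphI)
    show "simple_graph (insert v V) ?T"
      using simple assms nsets_mono[of V "insert v V" 2] by (auto simp: simple_graph_def)
    show "u \<in> insert v V"
      using assms(2) by simp
    show "(u, x) \<in> {(x, y). {x, y} \<in> ?T}\<^sup>*" if "x \<in> insert v V" for x
    proof (cases "x = v")
      case False
      then have "(u, x) \<in> {(x, y). {x, y} \<in> T}\<^sup>*"
        using conn that assms(2) by (auto simp: connected_graph_def)
      then show ?thesis
        by (rule rev_subsetD[OF _ rtrancl_mono]) auto
    qed auto
  qed
  moreover have "\<not> is_cycle ?T p" for p
  proof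
    assume cyc: "is_cycle ?T p"
    show False
    proof (cases "v \<in> set p")
      case True
      have "neighbours T v = {}"
        using simple_graph_edge(1)[OF simple] assms(3) by (auto simp: neighbours_def)
      then have "neighbours ?T v \<subseteq> {u}"
        by (auto simp: neighbours_def doubleton_eq_iff)
      moreover obtain x y where "x \<noteq> y" "x \<in> neighbours ?T v" "y \<in> neighbours ?T v"
        using is_cycle_two_neighbours[OF cyc True] .
      ultimately show False
        by auto
    next
      case False
      have "is_cycle T p"
        unfolding is_cycle_def
      proof (intro conjI allI impI)
        fix i assume i: "i < length p"
        then have "p ! i \<in> set p" "p ! (Suc i mod length p) \<in> set p"
          by (auto intro!: nth_mem mod_less_divisor)
        moreover have "{p ! i, p ! (Suc i mod length p)} \<in> ?T"
          using cyc i by (auto simp: is_cycle_def)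
        ultimately show "{p ! i, p ! (Suc i mod length p)} \<in> T"
          using False by (auto simp: doubleton_eq_iff)
      qed (use cyc in \<open>auto simp: is_cycle_def\<close>)
      then show False
        using assms(1) by (auto simp: tree_def)
    qed
  qed
  ultimately show ?thesis
    by (simp add: tree_def)
qed

lemma tree_attach_leaves:
  assumes "finite B" "tree V T" "B \<inter> V = {}" "f ` B \<subseteq> V"
  shows "tree (V \<union> B) (T \<union> (\<lambda>b. {f b, b}) ` B)"
  using assms
proof (induction B)
  case (insert b B)
  then have "tree (insert b (V \<union> B)) (insert {f b, b} (T \<union> (\<lambda>b. {f b, b}) ` B))"
    by (intro tree_attach_leaf) auto
  then show ?case by simp
qed simp

lemma vertex_degree_attach_leaves:
  assumes "finite B" "simple_graph V T" "B \<inter> V = {}" "f ` B \<subseteq> V"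
  shows "u \<in> V \<Longrightarrow> vertex_degree (T \<union> (\<lambda>b. {f b, b}) ` B) u
           = vertex_degree T u + card {b \<in> B. f b = u}"
    and "u \<in> B \<Longrightarrow> vertex_degree (T \<union> (\<lambda>b. {f b, b}) ` B) u = 1"
proof -
  let ?T = "T \<union> (\<lambda>b. {f b, b}) ` B"
  note sub = neighbours_subset[OF assms(2)]
  show "vertex_degree ?T u = vertex_degree T u + card {b \<in> B. f b = u}" if "u \<in> V"
  proof -
    have "neighbours ?T u = neighbours T u \<union> {b \<in> B. f b = u}"
      using that assms(3) by (auto simp: neighbours_def doubleton_eq_iff)
    moreover have "neighbours T u \<inter> {b \<in> B. f b = u} = {}"
      using sub assms(3) by blast
    ultimately show ?thesis
      using finite_neighbours[OF assms(2)] assms(1)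
      by (simp add: vertex_degree_def card_Un_disjoint)
  qed
  show "vertex_degree ?T u = 1" if "u \<in> B"
  proof -
    have "u \<notin> V" and "f b \<notin> B" if "b \<in> B" for b
      using that \<open>u \<in> B\<close> assms(3,4) by blast+
    moreover from this have "neighbours T u = {}"
      using simple_graph_edge(1)[OF assms(2)] \<open>u \<in> B\<close> by (auto simp: neighbours_def)
    ultimately have "neighbours ?T u = {f u}"
      using that by (auto simp: neighbours_def doubleton_eq_iff)
    then show ?thesis
      by (simp add: vertex_degree_def)
  qed
qed

text \<open>The tree is a path from \<open>a\<close> to \<open>z\<close> whose inner vertices are
  those of \<open>P\<close>.\<close>

lemma path_tree_exists:
  assumes "finite P" "a \<notin> P" "z \<notin> P" "a \<noteq> z"
  obtains T where "tree (insert a (insert z P)) T"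
    "vertex_degree T a = 1" "vertex_degree T z = 1" "\<forall>p\<in>P. vertex_degree T p = 2"
  using assms
proof (induction P arbitrary: z thesis)
  case empty
  have "tree {a, z} {{a, z}}"
    using tree_attach_leaf[OF tree_singleton, of a a z] \<open>a \<noteq> z\<close> by (simp add: insert_commute)
  moreover have "neighbours {{a, z}} a = {z}" "neighbours {{a, z}} z = {a}"
    by (auto simp: neighbours_def doubleton_eq_iff)
  ultimately show ?case
    using empty.prems(1) by (simp add: vertex_degree_def)
next
  case (insert p P)
  \<comment> \<open>The induction hypothesis is used with \<open>p\<close> as the end point in place
    of \<open>z\<close>; hanging \<open>z\<close> on \<open>p\<close> then raises the degree of
    \<open>p\<close> from 1 to 2.\<close>
  then obtain T where T: "tree (insert a (insert p P)) T" "vertex_degree T a = 1"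
    "vertex_degree T p = 1" "\<forall>p\<in>P. vertex_degree T p = 2"
    by (metis insertI1 insertI2)
  let ?V = "insert a (insert p P)"
  let ?T = "T \<union> (\<lambda>b. {p, b}) ` {z}"
  have simple: "simple_graph ?V T"
    using T by (simp add: tree_def connected_graph_def)
  have "tree (?V \<union> {z}) ?T"
    using T insert.prems by (intro tree_attach_leaves) auto
  moreover have "vertex_degree ?T u = vertex_degree T u + card {b \<in> {z}. p = u}" if "u \<in> ?V" for u
    using vertex_degree_attach_leaves(1)[OF _ simple, of "{z}" "\<lambda>_. p"] that insert.prems by auto
  then have "vertex_degree ?T u = vertex_degree T u + (if u = p then 1 else 0)" if "u \<in> ?V" for u
    using that by (auto simp: Collect_conv_if)
  moreover have "vertex_degree ?T z = 1"
    using vertex_degree_attach_leaves(2)[OF _ simple, of "{z}" "\<lambda>_. p"] insert.prems by auto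
  ultimately show ?case
    using T insert by (intro insert.prems(1)[of ?T]) (auto simp: insert_commute)
qed

text \<open>The tree is a path from \<open>a\<close> to \<open>z\<close> through all of
  \<open>C - S\<close>, with the other vertices of \<open>S\<close> hung on \<open>h\<close>. In the
  application, \<open>S\<close> is the set of vertices whose load is not 1.\<close>

lemma tree_with_leaves_exists:
  assumes "finite C" "S \<subseteq> C" "a \<in> S" "z \<in> S" "a \<noteq> z" "h \<in> insert a (C - S)"
  obtains T where "tree C T" "\<forall>u\<in>S - {h}. vertex_degree T u = 1"
    "\<forall>u\<in>C. vertex_degree T u \<ge> 1" "\<forall>u\<in>C - S. vertex_degree T u \<ge> 2"
proof -
  have "finite (C - S)" "a \<notin> C - S" "z \<notin> C - S"
    using assms by auto
  then obtain T where T: "tree (insert a (insert z (C - S))) T"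
    "vertex_degree T a = 1" "vertex_degree T z = 1" "\<forall>p\<in>C - S. vertex_degree T p = 2"
    using path_tree_exists[OF _ _ _ assms(5)] by metis
  let ?V = "insert a (insert z (C - S))"
  define R where "R = S - {a, z}"
  let ?T = "T \<union> (\<lambda>b. {h, b}) ` R"
  have simple: "simple_graph ?V T"
    using T by (simp add: tree_def connected_graph_def)
  have R: "finite R" "R \<inter> ?V = {}" "(\<lambda>_. h) ` R \<subseteq> ?V" and C: "?V \<union> R = C"
    using assms by (auto simp: R_def intro: finite_subset)
  have "tree (?V \<union> R) ?T"
    using tree_attach_leaves[OF R(1) T(1) R(2,3)] .
  note deg = vertex_degree_attach_leaves[OF R(1) simple R(2,3)]
  have "\<forall>u\<in>S - {h}. vertex_degree ?T u = 1"
  proof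
    fix u assume u: "u \<in> S - {h}"
    then consider "u \<in> R" | "u = a" | "u = z"
      by (auto simp: R_def)
    then show "vertex_degree ?T u = 1"
      using deg T u by cases auto
  qed
  have "vertex_degree ?T u \<ge> 1" if "u \<in> C" for u
  proof (cases "u \<in> R")
    case False
    then have "u \<in> ?V"
      using that C by blast
    moreover from this have "vertex_degree T u \<ge> 1"
      using T by fastforce
    ultimately show ?thesis
      using deg(1)[of u] by linarith
  qed (simp add: deg(2))
  moreover have "vertex_degree ?T u \<ge> 2" if "u \<in> C - S" for u
    using T that deg(1)[of u] by simp
  ultimately show thesis
    using that[of ?T] \<open>tree (?V \<union> R) ?T\<close> \<open>\<forall>u\<in>S - {h}. vertex_degree ?T u = 1\<close> C by simp
qed

section \<open>Construction of a HIST\<close>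

text \<open>Once \<open>I\<close> is hung on a tree on \<open>C\<close> along \<open>f\<close>, the
  degree of a vertex of \<open>C\<close> is its degree in that tree plus its load. Load 1 meets tree
  degree at least 2, and any other load meets tree degree 1, except that at \<open>h\<close> a load
  of at least 2 is added to a positive degree. So the total is never 2.\<close>

lemma HIST_exists_if_two_loads_ne_1:
  assumes split: "split_graph C I E" and "I \<noteq> {}"
    and f: "\<forall>i\<in>I. f i \<in> neighbours E i \<inter> C"
    and az: "a \<in> C" "z \<in> C" "a \<noteq> z" "card {i \<in> I. f i = a} \<noteq> 1" "card {i \<in> I. f i = z} \<noteq> 1"
  shows "\<exists>T. HIST (C \<union> I) E T"
proof -
  define load where "load u = card {i \<in> I. f i = u}" for u
  define S where "S = {u \<in> C. load u \<noteq> 1}"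
  have fin: "finite C" "finite I" and disj: "I \<inter> C = {}" and clique: "clique C E"
    using split by (auto simp: split_graph_def simple_graph_def)
  have "a \<in> S" "z \<in> S"
    using az by (auto simp: S_def load_def)
  \<comment> \<open>The end points of the path, and the vertex on which the rest of \<open>S\<close> is hung.\<close>
  obtain r s h where rs: "r \<in> S" "s \<in> S" "r \<noteq> s" and h: "h \<in> insert r (C - S)"
    "h \<in> S \<longrightarrow> load h \<ge> 2"
  proof (cases "C - S = {}")
    case False
    then obtain h where "h \<in> C - S" by blast
    then show thesis
      using \<open>a \<in> S\<close> \<open>z \<in> S\<close> az that[of a z h] by blast
  next
    case True
    \<comment> \<open>No vertex has load 1, so \<open>h\<close> must be an end of the path that has
      load at least 2. A value of \<open>f\<close> has positive load and therefore qualifies; one of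
      \<open>a\<close> and \<open>z\<close> differs from it and becomes the other end.\<close>
    obtain i where i: "i \<in> I"
      using \<open>I \<noteq> {}\<close> by blast
    let ?r = "f i"
    have "?r \<in> S"
      using i f True by blast
    then have "load ?r \<noteq> 1"
      by (simp add: S_def)
    moreover have "load ?r \<noteq> 0"
      using i fin by (auto simp: load_def)
    ultimately have "load ?r \<ge> 2"
      by linarith
    then show thesis
      using \<open>a \<in> S\<close> \<open>z \<in> S\<close> az \<open>?r \<in> S\<close>
        that[of ?r a ?r] that[of ?r z ?r] by (cases "?r = a") auto
  qed
  have "S \<subseteq> C"
    by (auto simp: S_def)
  obtain T where T: "tree C T" "\<forall>u\<in>S - {h}. vertex_degree T u = 1"
    "\<forall>u\<in>C. vertex_degree T u \<ge> 1" "\<forall>u\<in>C - S. vertex_degree T u \<ge> 2"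
    using tree_with_leaves_exists[OF fin(1) \<open>S \<subseteq> C\<close> rs h(1)] .
  have simple: "simple_graph C T"
    using T by (simp add: tree_def connected_graph_def)
  let ?T = "T \<union> (\<lambda>i. {f i, i}) ` I"
  have fC: "f ` I \<subseteq> C"
    using f by blast
  have "tree (C \<union> I) ?T"
    using tree_attach_leaves[OF fin(2) T(1) disj fC] .
  moreover have "e \<in> E" if "e \<in> T" for e
  proof -
    obtain u v where "e = {u, v}" "u \<in> C" "v \<in> C" "u \<noteq> v"
      using simple_graph_edge_cases[OF simple \<open>e \<in> T\<close>] .
    then show ?thesis
      using clique by (simp add: clique_def)
  qed
  moreover have "{f i, i} \<in> E" if "i \<in> I" for i
    using f that by (auto simp: neighbours_def insert_commute)
  moreover have "vertex_degree ?T v \<noteq> 2" if "v \<in> C \<union> I" for v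
  proof (cases "v \<in> I")
    case True
    then show ?thesis
      using vertex_degree_attach_leaves(2)[OF fin(2) simple disj fC] by simp
  next
    case False
    with that have "v \<in> C" by blast
    then have deg: "vertex_degree ?T v = vertex_degree T v + load v"
      using vertex_degree_attach_leaves(1)[OF fin(2) simple disj fC] by (simp add: load_def)
    show ?thesis
    proof (cases "v \<in> S")
      case True
      show ?thesis
      proof (cases "v = h")
        case True
        then have "load v \<ge> 2"
          using \<open>v \<in> S\<close> h(2) by simp
        moreover have "vertex_degree T v \<ge> 1"
          using T(3) \<open>v \<in> C\<close> by blast
        ultimately show ?thesis
          using deg by linarith
      next
        case False
        then have "vertex_degree T v = 1"
          using T(2) \<open>v \<in> S\<close> by blast
        moreover have "load v \<noteq> 1"
          using \<open>v \<in> S\<close> by (simp add: S_def)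
        ultimately show ?thesis
          using deg by linarith
      qed
    next
      case False
      then have "load v = 1"
        using \<open>v \<in> C\<close> by (simp add: S_def)
      moreover have "vertex_degree T v \<ge> 2"
        using T(4) \<open>v \<in> C\<close> False by blast
      ultimately show ?thesis
        using deg by linarith
    qed
  qed
  ultimately have "HIST (C \<union> I) E ?T"
    by (auto simp: HIST_def spanning_tree_def)
  then show ?thesis by blast
qed

section \<open>Assignments\<close>

lemma bij_betw_if_fibres_card_1:
  assumes "f ` J \<subseteq> D" "\<And>u. u \<in> D \<Longrightarrow> card {i \<in> J. f i = u} = 1"
  shows "bij_betw f J D"
proof (rule bij_betw_imageI)
  show "inj_on f J"
  proof (rule inj_onI)
    fix i j assume ij: "i \<in> J" "j \<in> J" "f i = f j"
    then have "card {k \<in> J. f k = f i} = 1"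
      using assms by blast
    then obtain k where "{k \<in> J. f k = f i} = {k}"
      by (auto simp: card_1_singleton_iff)
    moreover have "i \<in> {k \<in> J. f k = f i}" "j \<in> {k \<in> J. f k = f i}"
      using ij by auto
    ultimately show "i = j"
      by auto
  qed
  show "f ` J = D"
  proof
    show "D \<subseteq> f ` J"
    proof
      fix u assume "u \<in> D"
      then have "card {i \<in> J. f i = u} \<noteq> 0"
        using assms(2) by simp
      then have "{i \<in> J. f i = u} \<noteq> {}"
        by (metis card.empty)
      then show "u \<in> f ` J" by auto
    qed
  qed (fact assms(1))
qed

text \<open>\<open>N i\<close> stands for the neighbourhood of \<open>i\<close>, and
  \<open>unique\<close> says that no choice leaves two vertices with load different from 1. That
  \<open>v\<close> can move from \<open>x\<close> to \<open>y\<close> forces the loads at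
  \<open>x\<close> and \<open>y\<close> to be 2 and 1, or 1 and 0, with load 1 elsewhere. Without
  \<open>v\<close>, the remaining choices then either fill \<open>C\<close> or miss exactly
  \<open>x\<close> and \<open>y\<close>.\<close>

lemma assignment_with_one_exceptional_load:
  fixes N :: "'b \<Rightarrow> 'a set"
  assumes "finite I" and N: "\<And>i. i \<in> I \<Longrightarrow> N i \<subseteq> C"
    and v: "v \<in> I" and xy: "x \<in> N v" "y \<in> N v" "x \<noteq> y"
    and f: "\<And>i. i \<in> I \<Longrightarrow> f i \<in> N i" "f v = x"
    and unique: "\<And>g a z. (\<And>i. i \<in> I \<Longrightarrow> g i \<in> N i) \<Longrightarrow> a \<in> C \<Longrightarrow> z \<in> C \<Longrightarrow> a \<noteq> z \<Longrightarrow>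
      card {i \<in> I. g i = a} = 1 \<or> card {i \<in> I. g i = z} = 1"
  shows "(\<forall>i\<in>I - {v}. N i = {f i}) \<and>
    (bij_betw f (I - {v}) C \<or> N v = {x, y} \<and> bij_betw f (I - {v}) (C - {x, y}))"
proof -
  define load where "load g u = card {i \<in> I. g i = u}" for g :: "'b \<Rightarrow> 'a" and u
  have load_pos: "load g (g i) \<ge> 1" if "i \<in> I" for g i
  proof -
    have "{j \<in> I. g j = g i} \<noteq> {}"
      using that by auto
    then show ?thesis
      using \<open>finite I\<close> by (simp add: load_def Suc_le_eq card_gt_0_iff)
  qed
  have fib: "load g u = card {i \<in> I - {w}. g i = u} + (if g w = u then 1 else 0)" if "w \<in> I" for g u w
  proof (cases "g w = u")
    case True
    then have "{i \<in> I. g i = u} = insert w {i \<in> I - {w}. g i = u}"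
      using that by auto
    then show ?thesis
      using True \<open>finite I\<close> by (simp add: load_def)
  next
    case False
    then have "{i \<in> I. g i = u} = {i \<in> I - {w}. g i = u}"
      by auto
    then show ?thesis
      using False by (simp add: load_def)
  qed
  have upd: "load (g(w := j)) u = card {i \<in> I - {w}. g i = u} + (if j = u then 1 else 0)"
    if "w \<in> I" for g u w j
  proof -
    have "{i \<in> I - {w}. (g(w := j)) i = u} = {i \<in> I - {w}. g i = u}"
      by auto
    then show ?thesis
      using fib[OF that, of "g(w := j)" u] by simp
  qed
  \<comment> \<open>The move lowers the load at \<open>g w\<close> by 1 and raises that at
    \<open>j\<close> by 1. By \<open>unique\<close>, one of the two new loads is 1, so the old ones
    satisfy \<open>load g (g w) = 2\<close> or \<open>load g j = 0\<close>. One of the old loads is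
    1 as well, which leaves the two patterns; each has its exceptional vertex among these two, so
    all others have load 1.\<close>
  have switch: "(load g (g w) = 2 \<and> load g j = 1 \<or> load g (g w) = 1 \<and> load g j = 0) \<and>
      (\<forall>u\<in>C - {g w, j}. load g u = 1)"
    if g: "\<And>i. i \<in> I \<Longrightarrow> g i \<in> N i" and w: "w \<in> I" and j: "j \<in> N w" "j \<noteq> g w" for g w j
  proof -
    have C: "g w \<in> C" "j \<in> C"
      using N w j g by blast+
    have "load (g(w := j)) (g w) = 1 \<or> load (g(w := j)) j = 1"
      unfolding load_def using C j w g by (intro unique) auto
    then have "load g (g w) = 2 \<or> load g j = 0"
      using upd[OF w, of g j] fib[OF w, of g] j by auto
    moreover have one: "load g a = 1 \<or> load g z = 1" if "a \<in> C" "z \<in> C" "a \<noteq> z" for a z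
      unfolding load_def using unique[of g a z] g that by blast
    ultimately show ?thesis
      using C j one[of "g w" j] by (smt (verit) DiffE insertCI one_neq_zero numeral_eq_one_iff semiring_norm(85) one)
  qed
  \<comment> \<open>The choice after moving \<open>v\<close> from \<open>x\<close> to
    \<open>y\<close>. The loads 2 and 1 at \<open>x\<close> and \<open>y\<close> become 1 and 2, and
    the loads 1 and 0 become 0 and 1, so the exceptional vertex changes sides.\<close>
  define f' where "f' = f(v := y)"
  have f': "f' i \<in> N i" if "i \<in> I" for i
    using that f xy by (auto simp: f'_def)
  have f'_eq: "f' i = f i" if "i \<noteq> v" for i
    using that by (simp add: f'_def)
  have load': "load f' x + 1 = load f x" "load f' y = load f y + 1"
    "\<And>u. u \<noteq> x \<Longrightarrow> u \<noteq> y \<Longrightarrow> load f' u = load f u"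
    unfolding f'_def using upd[OF v, of f y] fib[OF v, of f] xy f(2) by auto
  have sw: "load f x = 2 \<and> load f y = 1 \<or> load f x = 1 \<and> load f y = 0"
    "\<And>u. u \<in> C \<Longrightarrow> u \<noteq> x \<Longrightarrow> u \<noteq> y \<Longrightarrow> load f u = 1"
    using switch[OF f(1) v xy(2)] xy(3) f(2) by auto
  have C: "x \<in> C" "y \<in> C"
    using N v xy by blast+
  have single: "N i = {f i}" if i: "i \<in> I - {v}" for i
  proof (rule ccontr)
    assume "N i \<noteq> {f i}"
    with f(1) i obtain j where j: "j \<in> N i" "j \<noteq> f i"
      by blast
    have iI: "i \<in> I" and fi: "f' i = f i" and "f i \<in> C" and "j \<in> C"
      using i f'_eq N f(1) j by auto
    have A: "load f (f i) = 2 \<and> load f j = 1 \<or> load f (f i) = 1 \<and> load f j = 0"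
      using switch[OF f(1) iI j] by blast
    have B: "load f' (f i) = 2 \<and> load f' j = 1 \<or> load f' (f i) = 1 \<and> load f' j = 0"
      using switch[of f' i j] f' iI j fi by simp
    have fx: "f i = x \<longrightarrow> load f x \<ge> 2"
    proof
      assume "f i = x"
      then have "{i, v} \<subseteq> {k \<in> I. f k = x}"
        using iI v f(2) by auto
      then have "card {i, v} \<le> load f x"
        unfolding load_def using \<open>finite I\<close> by (intro card_mono) auto
      then show "load f x \<ge> 2"
        using i by simp
    qed
    show False
      using sw(1)
    proof
      \<comment> \<open>Under \<open>f\<close> only \<open>x\<close> has load 2 and no vertex has
        load 0, so \<open>i\<close> would have to leave \<open>x\<close>. Under \<open>f'\<close>
        the load at \<open>x\<close> is 1, so \<open>j\<close> would need load 0, which it does not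
        have.\<close>
      assume *: "load f x = 2 \<and> load f y = 1"
      have "load f j \<noteq> 0"
        using * sw(2)[OF \<open>j \<in> C\<close>] by (cases "j = x"; cases "j = y") auto
      then have "load f (f i) = 2"
        using A by simp
      then have "f i = x"
        using * sw(2)[OF \<open>f i \<in> C\<close>] by (cases "f i = x"; cases "f i = y") auto
      then have "load f' (f i) = 1"
        using * load'(1) by simp
      moreover have "load f' j \<noteq> 0"
        using * \<open>load f j \<noteq> 0\<close> load'(2,3) j \<open>f i = x\<close> by (cases "j = y") auto
      ultimately show False
        using B by simp
    next
      \<comment> \<open>Only \<open>v\<close> is sent to \<open>x\<close>, so \<open>i\<close> sits
        at another vertex, of load 1, and only \<open>y\<close>, of load 0, can receive it. Under
        \<open>f'\<close> both loads are 1, which fits neither pattern.\<close>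
      assume *: "load f x = 1 \<and> load f y = 0"
      have "f i \<noteq> x"
        using * fx by auto
      moreover have "f i \<noteq> y"
        using load_pos[OF iI, of f] * by auto
      ultimately have "load f (f i) = 1"
        using sw(2)[OF \<open>f i \<in> C\<close>] by simp
      then have "load f j = 0"
        using A by simp
      then have "j = y"
        using * sw(2)[OF \<open>j \<in> C\<close>] by (cases "j = x"; cases "j = y") auto
      then have "load f' j = 1"
        using * load'(2) by simp
      moreover have "load f' (f i) = 1"
        using \<open>load f (f i) = 1\<close> load'(3) \<open>f i \<noteq> x\<close> \<open>f i \<noteq> y\<close> by simp
      ultimately show False
        using B by simp
    qed
  qed
  \<comment> \<open>The subtraction on \<open>nat\<close> is exact, since \<open>v\<close> itself
    contributes 1 to \<open>load f x\<close>.\<close>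
  have rest: "card {i \<in> I - {v}. f i = u} = load f u - (if u = x then 1 else 0)" for u
    using fib[OF v, of f u] f(2) by auto
  have fC: "f i \<in> C" if "i \<in> I" for i
    using that f N by blast
  show ?thesis
    using sw(1)
  proof
    assume *: "load f x = 2 \<and> load f y = 1"
    have "bij_betw f (I - {v}) C"
    proof (rule bij_betw_if_fibres_card_1)
      show "card {i \<in> I - {v}. f i = u} = 1" if "u \<in> C" for u
        unfolding rest using * sw(2)[OF that] xy(3) by (cases "u = y") auto
    qed (use fC in auto)
    then show ?thesis
      using single by simp
  next
    assume *: "load f x = 1 \<and> load f y = 0"
    have "f i \<noteq> x \<and> f i \<noteq> y" if "i \<in> I - {v}" for i
    proof -
      have "card {k \<in> I - {v}. f k = f i} \<noteq> 0"
        using that \<open>finite I\<close> by auto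
      then show ?thesis
        unfolding rest using * by (auto split: if_splits)
    qed
    then have "f ` (I - {v}) \<subseteq> C - {x, y}"
      using fC by blast
    moreover have "card {i \<in> I - {v}. f i = u} = 1" if "u \<in> C - {x, y}" for u
      unfolding rest using that sw(2) by simp
    ultimately have "bij_betw f (I - {v}) (C - {x, y})"
      by (rule bij_betw_if_fibres_card_1)
    \<comment> \<open>A third neighbour \<open>j\<close> of \<open>v\<close> would have load 1, as
      \<open>x\<close> has, but moving \<open>v\<close> from \<open>x\<close> to \<open>j\<close>
      requires one of the two patterns.\<close>
    moreover have "j \<in> {x, y}" if j: "j \<in> N v" for j
    proof (rule ccontr)
      assume "j \<notin> {x, y}"
      then have "load f j = 1"
        using sw(2) N v j by blast
      moreover have "load f (f v) = 2 \<and> load f j = 1 \<or> load f (f v) = 1 \<and> load f j = 0"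
        using switch[OF f(1) v j] \<open>j \<notin> {x, y}\<close> f(2) by blast
      ultimately show False
        using * f(2) by simp
    qed
    ultimately show ?thesis
      using single xy by blast
  qed
qed

section \<open>The exceptional split graphs\<close>

lemma split_graph_neighbours_subset:
  assumes "split_graph C I E" "i \<in> I"
  shows "neighbours E i \<subseteq> C"
proof
  fix u assume u: "u \<in> neighbours E i"
  have simple: "simple_graph (C \<union> I) E" and indep: "indep I E"
    using assms by (auto simp: split_graph_def)
  have "u \<in> C \<union> I" "u \<noteq> i"
    using neighbours_subset[OF simple] u by auto
  moreover have "{i, u} \<in> E"
    using u by (simp add: neighbours_iff)
  ultimately show "u \<in> C"
    using indep assms(2) by (auto simp: indep_def)
qed

text \<open>For connected graphs, the degrees of the vertices of \<open>I\<close> sum to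
  \<open>card C = card I + 1\<close>, so one of them has degree 2 and all others are leaves. The
  difference is taken over \<open>int\<close> to avoid truncation.\<close>

definition perfectly_pendant :: "'a set \<Rightarrow> 'a set \<Rightarrow> 'a set set \<Rightarrow> bool" where
  "perfectly_pendant C I E \<longleftrightarrow>
     (\<forall>u\<in>C. card (neighbours E u \<inter> I) = 1) \<and> int (card C) - int (card I) = 1"

text \<open>For connected graphs this says that every vertex of \<open>C\<close> has a private leaf
  in \<open>I\<close>, and that \<open>I\<close> has just one further vertex, whose neighbourhood is
  \<open>U\<close>.\<close>

definition pendant_star :: "'a set \<Rightarrow> 'a set \<Rightarrow> 'a set set \<Rightarrow> bool" where
  "pendant_star C I E \<longleftrightarrow>
     (let U = {u \<in> C. card (neighbours E u \<inter> I) = 2} in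
         (\<forall>u\<in>C. card (neighbours E u \<inter> I) \<in> {1, 2}) \<and> card U \<ge> 2
       \<and> inj_on (\<lambda>u. neighbours E u \<inter> I) U
       \<and> (\<forall>u\<in>C - U. \<exists>v. neighbours E u \<inter> I = {v} \<and> pendant E v)
       \<and> card (\<Inter>u\<in>U. neighbours E u \<inter> I) = 1)"

text \<open>The inverse \<open>g\<close> of \<open>f\<close> assigns to each vertex of
  \<open>C\<close> its private leaf. The set \<open>U\<close> turns out to be the neighbourhood of
  \<open>v\<close>, and \<open>v\<close> is the vertex common to all its members.\<close>

lemma pendant_star_if_bij:
  assumes split: "split_graph C I E" and v: "v \<in> I" and deg: "vertex_degree E v \<ge> 2"
    and nbr: "\<And>i. i \<in> I - {v} \<Longrightarrow> neighbours E i = {f i}" and bij: "bij_betw f (I - {v}) C"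
  shows "pendant_star C I E"
proof -
  define g where "g = inv_into (I - {v}) f"
  have g: "g u \<in> I - {v}" "f (g u) = u" if "u \<in> C" for u
    unfolding g_def using bij that
    by (simp_all only: bij_betw_def inv_into_into f_inv_into_f)
  have gf: "g (f i) = i" if "i \<in> I - {v}" for i
    using bij that by (simp add: g_def bij_betw_def)
  have vC: "neighbours E v \<subseteq> C"
    using split_graph_neighbours_subset[OF split v] .
  have eq: "neighbours E u \<inter> I = (if u \<in> neighbours E v then {g u, v} else {g u})"
    if u: "u \<in> C" for u
  proof -
    have "i \<in> neighbours E u \<longleftrightarrow> i = g u" if "i \<in> I - {v}" for i
    proof -
      have "i \<in> neighbours E u \<longleftrightarrow> u = f i"
        using neighbours_sym[of i E u] nbr[OF that] by simp
      then show ?thesis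
        using g(2)[OF u] gf[OF that] by metis
    qed
    then show ?thesis
      using g[OF u] v neighbours_sym[of v E u] by auto
  qed
  have card_eq: "card (neighbours E u \<inter> I) = (if u \<in> neighbours E v then 2 else 1)" if "u \<in> C" for u
    using eq[OF that] g[OF that] by auto
  then have U: "{u \<in> C. card (neighbours E u \<inter> I) = 2} = neighbours E v"
    using vC by (auto split: if_splits)
  have inj: "inj_on (\<lambda>u. neighbours E u \<inter> I) (neighbours E v)"
  proof (rule inj_onI)
    fix p q assume *: "p \<in> neighbours E v" "q \<in> neighbours E v"
      "neighbours E p \<inter> I = neighbours E q \<inter> I"
    then have C: "p \<in> C" "q \<in> C"
      using vC by auto
    then have "g p = g q"
      using * eq g by (auto simp: doubleton_eq_iff)
    then show "p = q"
      using g C by metis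
  qed
  have pend: "\<exists>i. neighbours E u \<inter> I = {i} \<and> pendant E i" if "u \<in> C - neighbours E v" for u
    using eq[of u] g[of u] nbr[of "g u"] that by (auto simp: pendant_def vertex_degree_def)
  obtain x y where xy: "x \<in> neighbours E v" "y \<in> neighbours E v" "x \<noteq> y"
    using deg by (auto simp: vertex_degree_def numeral_2_eq_2 card_le_Suc_iff)
  have "(\<Inter>u\<in>neighbours E v. neighbours E u \<inter> I) = {v}"
  proof
    have "g x \<noteq> g y"
      using xy g vC by (metis subsetD)
    moreover have "neighbours E x \<inter> I = {g x, v}" "neighbours E y \<inter> I = {g y, v}"
      using xy vC eq[of x] eq[of y] by auto
    ultimately have "(neighbours E x \<inter> I) \<inter> (neighbours E y \<inter> I) \<subseteq> {v}"
      by (simp only:) auto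
    then show "(\<Inter>u\<in>neighbours E v. neighbours E u \<inter> I) \<subseteq> {v}"
      using xy by blast
    show "{v} \<subseteq> (\<Inter>u\<in>neighbours E v. neighbours E u \<inter> I)"
      using v neighbours_sym by fast
  qed
  then show ?thesis
    unfolding pendant_star_def Let_def U
    using card_eq deg inj pend by (simp add: vertex_degree_def)
qed

text \<open>Each vertex of \<open>C\<close> other than \<open>x\<close> and \<open>y\<close> is
  matched with a private leaf, while \<open>x\<close> and \<open>y\<close> share \<open>v\<close>;
  the matching also compares the cardinalities.\<close>

lemma perfectly_pendant_if_bij:
  assumes split: "split_graph C I E" and v: "v \<in> I"
    and Nv: "neighbours E v = {x, y}" "x \<noteq> y"
    and nbr: "\<And>i. i \<in> I - {v} \<Longrightarrow> neighbours E i = {f i}"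
    and bij: "bij_betw f (I - {v}) (C - {x, y})"
  shows "perfectly_pendant C I E"
proof -
  define g where "g = inv_into (I - {v}) f"
  have g: "g u \<in> I - {v}" "f (g u) = u" if "u \<in> C - {x, y}" for u
    unfolding g_def using bij that
    by (simp_all only: bij_betw_def inv_into_into f_inv_into_f)
  have gf: "g (f i) = i" "f i \<in> C - {x, y}" if "i \<in> I - {v}" for i
    using bij that by (auto simp: g_def bij_betw_def)
  have xyC: "{x, y} \<subseteq> C"
    using split_graph_neighbours_subset[OF split v] Nv by simp
  have fin: "finite C" "finite I"
    using split by (auto simp: split_graph_def simple_graph_def)
  have "card (neighbours E u \<inter> I) = 1" if u: "u \<in> C" for u
  proof (cases "u \<in> {x, y}")
    case True
    have "i \<notin> neighbours E u" if "i \<in> I - {v}" for i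
      using nbr[OF that] neighbours_sym[of i E u] gf(2)[OF that] True by auto
    moreover have "v \<in> neighbours E u"
      using neighbours_sym[of v E u] Nv True by simp
    ultimately have "neighbours E u \<inter> I = {v}"
      using v by blast
    then show ?thesis by simp
  next
    case False
    then have u': "u \<in> C - {x, y}"
      using u by blast
    have "i \<in> neighbours E u \<longleftrightarrow> i = g u" if "i \<in> I - {v}" for i
    proof -
      have "i \<in> neighbours E u \<longleftrightarrow> u = f i"
        using neighbours_sym[of i E u] nbr[OF that] by simp
      then show ?thesis
        using g(2)[OF u'] gf(1)[OF that] by metis
    qed
    moreover have "v \<notin> neighbours E u"
      using neighbours_sym[of v E u] Nv False by simp
    ultimately have "neighbours E u \<inter> I = {g u}"
      using g[OF u'] by blast
    then show ?thesis by simp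
  qed
  \<comment> \<open>Both subtractions are on \<open>nat\<close>; the two lower bounds that follow
    make them exact, so that the equation carries over to \<open>int\<close>.\<close>
  moreover have "card I - 1 = card C - 2"
    using bij_betw_same_card[OF bij] v xyC Nv(2) fin by (simp add: card_Diff_subset)
  moreover have "card I \<ge> 1"
    using v fin by (auto simp: Suc_le_eq card_gt_0_iff)
  moreover have "card C \<ge> 2"
    using card_mono[OF fin(1) xyC] Nv(2) by simp
  ultimately show ?thesis
    by (auto simp: perfectly_pendant_def)
qed

text \<open>A choice with two loads different from 1 would yield a HIST, so the premise
  \<open>unique\<close> of \<open>assignment_with_one_exceptional_load\<close> holds; its two
  outcomes are the two exceptional families.\<close>

lemma no_HIST_imp_exceptional:
  assumes split: "split_graph C I E" and conn: "connected_graph (C \<union> I) E"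
    and v: "v \<in> I" and deg: "vertex_degree E v \<ge> 2"
    and no_HIST: "\<nexists>T. HIST (C \<union> I) E T"
  shows "perfectly_pendant C I E \<or> pendant_star C I E"
proof -
  have fin: "finite I" and disj: "C \<inter> I = {}"
    using split by (auto simp: split_graph_def simple_graph_def)
  have NC: "neighbours E i \<subseteq> C" if "i \<in> I" for i
    using split_graph_neighbours_subset[OF split that] .
  obtain x y where xy: "x \<in> neighbours E v" "y \<in> neighbours E v" "x \<noteq> y"
    using deg by (auto simp: vertex_degree_def numeral_2_eq_2 card_le_Suc_iff)
  have "neighbours E i \<noteq> {}" if "i \<in> I" for i
  proof -
    have "x \<in> C"
      using NC v xy by blast
    then have "vertex_degree E i \<ge> 1"
      using that disj by (intro connected_graph_vertex_degree_pos[OF conn, of i x]) auto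
    then show ?thesis
      by (auto simp: vertex_degree_def)
  qed
  then have "\<forall>i. \<exists>u. i \<in> I \<longrightarrow> u \<in> neighbours E i"
    by blast
  then obtain f0 where f0: "\<And>i. i \<in> I \<Longrightarrow> f0 i \<in> neighbours E i"
    by metis
  \<comment> \<open>The value at \<open>v\<close> is overwritten because the assignment must start
    with \<open>v\<close> sent to the prescribed neighbour \<open>x\<close>.\<close>
  define f where "f = f0(v := x)"
  have f: "f i \<in> neighbours E i" if "i \<in> I" for i
    using f0[OF that] xy by (simp add: f_def)
  have "card {i \<in> I. g i = a} = 1 \<or> card {i \<in> I. g i = z} = 1"
    if "\<And>i. i \<in> I \<Longrightarrow> g i \<in> neighbours E i" "a \<in> C" "z \<in> C" "a \<noteq> z" for g a z
    using HIST_exists_if_two_loads_ne_1[OF split, of g a z] no_HIST v that NC by blast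
  then have "(\<forall>i\<in>I - {v}. neighbours E i = {f i}) \<and>
    (bij_betw f (I - {v}) C \<or> neighbours E v = {x, y} \<and> bij_betw f (I - {v}) (C - {x, y}))"
    using f xy by (intro assignment_with_one_exceptional_load[OF fin NC v]) (auto simp: f_def)
  then show ?thesis
    using pendant_star_if_bij[OF split v deg, of f]
      perfectly_pendant_if_bij[OF split v _ xy(3), of f] by blast
qed

section \<open>Degree counting against a HIST\<close>

lemma HIST_leaf_neighbour:
  assumes "HIST V E T" "card V \<ge> 3" "{u, b} \<in> T" "vertex_degree T b = 1"
  shows "vertex_degree T u \<ge> 3"
proof -
  have conn: "connected_graph V T" and "\<forall>v\<in>V. vertex_degree T v \<noteq> 2"
    using assms(1) by (auto simp: HIST_def spanning_tree_def tree_def)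
  moreover have "u \<in> V"
    using simple_graph_edge(1)[OF _ assms(3)] conn by (auto simp: connected_graph_def)
  moreover have "vertex_degree T u \<ge> 2"
    using connected_graph_leaf_neighbour[OF conn assms(2-4)] .
  ultimately show ?thesis
    by force
qed

text \<open>Degrees at least 1 everywhere and at least 3 on \<open>L\<close> give a degree sum of at
  least \<open>card V + 2 * card L\<close>, whereas a tree has at most
  \<open>2 * card V - 2\<close>.\<close>

lemma HIST_degree_3_bound:
  assumes T: "HIST V E T" and "card V \<ge> 2" and L: "L \<subseteq> V" "\<And>u. u \<in> L \<Longrightarrow> vertex_degree T u \<ge> 3"
  shows "2 * card L + 2 \<le> card V"
proof -
  have tree: "tree V T"
    using T by (auto simp: HIST_def spanning_tree_def)
  then have conn: "connected_graph V T" and simple: "simple_graph V T" and "V \<noteq> {}" and fin: "finite V"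
    by (auto simp: tree_def connected_graph_def simple_graph_def)
  have pos: "vertex_degree T u \<ge> 1" if "u \<in> V" for u
  proof -
    have "\<not> V \<subseteq> {u}"
      using card_mono[of "{u}" V] \<open>card V \<ge> 2\<close> by auto
    then obtain w where "w \<in> V" "w \<noteq> u"
      by blast
    then show ?thesis
      using connected_graph_vertex_degree_pos[OF conn that] by auto
  qed
  have "card V + 2 * card L = (\<Sum>u\<in>V. 1 + (if u \<in> L then 2 else 0))"
    using fin L(1) by (simp only: sum.distrib) (simp add: sum.If_cases Int_absorb1)
  also have "\<dots> \<le> (\<Sum>u\<in>V. vertex_degree T u)"
    using pos L(2) by (intro sum_mono) auto
  also have "\<dots> + 2 \<le> 2 * card V"
    using acyclic_sum_vertex_degree[OF simple \<open>V \<noteq> {}\<close>] tree by (auto simp: tree_def)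
  finally show ?thesis
    by simp
qed

text \<open>All vertices of \<open>I\<close> are leaves of \<open>T\<close>, and their neighbours
  are distinct vertices of degree at least 3. The bound then gives
  \<open>2 * card I + 2 <= card C + card I = 2 * card I + 1\<close>.\<close>

lemma perfectly_pendant_no_HIST:
  assumes split: "split_graph C I E"
    and big: "card (C \<union> I) \<ge> 3" and "perfectly_pendant C I E"
  shows "\<not> HIST (C \<union> I) E T"
proof
  assume T: "HIST (C \<union> I) E T"
  have fin: "finite C" "finite I" and disj: "C \<inter> I = {}" and simple: "simple_graph (C \<union> I) E"
    using split by (auto simp: split_graph_def simple_graph_def)
  have one: "card (neighbours E u \<inter> I) = 1" if "u \<in> C" for u
    using assms that by (auto simp: perfectly_pendant_def)
  have card_C: "card C = card I + 1"
    using assms by (auto simp: perfectly_pendant_def)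
  have NC: "neighbours E i \<subseteq> C" if "i \<in> I" for i
    using split_graph_neighbours_subset[OF split that] .
  have TE: "T \<subseteq> E" and connT: "connected_graph (C \<union> I) T"
    and no2: "\<forall>v\<in>C \<union> I. vertex_degree T v \<noteq> 2"
    using T by (auto simp: HIST_def spanning_tree_def tree_def)
  obtain c where "c \<in> C"
    using card_C by fastforce
  then have posT: "vertex_degree T i \<ge> 1" if "i \<in> I" for i
    using connected_graph_vertex_degree_pos[OF connT, of i c] that disj by blast
  have le: "vertex_degree T i \<le> vertex_degree E i" for i
    unfolding vertex_degree_def
    by (intro card_mono finite_neighbours[OF simple] neighbours_mono[OF TE])
  \<comment> \<open>Double counting of the edges between \<open>C\<close> and
    \<open>I\<close>.\<close>
  have "(\<Sum>i\<in>I. card {u \<in> C. u \<in> neighbours E i}) = 1 * card C"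
  proof (rule sum_multicount[OF fin(2,1)], rule ballI)
    fix u assume "u \<in> C"
    have "{i \<in> I. u \<in> neighbours E i} = neighbours E u \<inter> I"
      using neighbours_sym[of u E] by blast
    then show "card {i \<in> I. u \<in> neighbours E i} = 1"
      using one[OF \<open>u \<in> C\<close>] by simp
  qed
  moreover have "{u \<in> C. u \<in> neighbours E i} = neighbours E i" if "i \<in> I" for i
    using NC[OF that] by blast
  ultimately have sum: "(\<Sum>i\<in>I. vertex_degree E i) = card I + 1"
    using card_C by (simp add: vertex_degree_def)
  have leaf: "vertex_degree T i = 1" if "i \<in> I" for i
  proof -
    \<comment> \<open>The other vertices of \<open>I\<close> account for at least
      \<open>card I - 1\<close> of the sum \<open>card I + 1\<close>, so at most 2 is left for
      \<open>i\<close>; degree 2 in \<open>T\<close> is excluded in a HIST.\<close>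
    have "(\<Sum>j\<in>I - {i}. 1) \<le> (\<Sum>j\<in>I - {i}. vertex_degree E j)"
      using posT le by (intro sum_mono) (metis DiffD1 le_trans)
    then have "vertex_degree E i \<le> 2"
      using sum sum.remove[OF fin(2) that, of "vertex_degree E"] that fin(2) by simp
    then show ?thesis
      using le[of i] posT[OF that] no2 that by force
  qed
  then have "\<forall>i. \<exists>u. i \<in> I \<longrightarrow> neighbours T i = {u}"
    by (metis card_1_singletonE vertex_degree_def)
  then obtain f where f: "\<And>i. i \<in> I \<Longrightarrow> neighbours T i = {f i}"
    by metis
  have fE: "f i \<in> neighbours E i" if "i \<in> I" for i
    using neighbours_mono[OF TE, of i] f[OF that] by blast
  then have fC: "f ` I \<subseteq> C"
    using NC by blast
  have "inj_on f I"
  proof (rule inj_onI)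
    fix i j assume ij: "i \<in> I" "j \<in> I" "f i = f j"
    then have "i \<in> neighbours E (f i) \<inter> I" "j \<in> neighbours E (f i) \<inter> I"
      using fE neighbours_sym[of _ E "f i"] by (metis IntI)+
    moreover have "card (neighbours E (f i) \<inter> I) = 1"
      using one fC ij by blast
    ultimately show "i = j"
      by (metis card_1_singletonE singletonD)
  qed
  moreover have "vertex_degree T u \<ge> 3" if "u \<in> f ` I" for u
  proof -
    obtain i where i: "i \<in> I" "u = f i"
      using \<open>u \<in> f ` I\<close> by blast
    then have "{u, i} \<in> T"
      using f[OF i(1)] by (auto simp: neighbours_def insert_commute)
    then show ?thesis
      using HIST_leaf_neighbour[OF T big] leaf[OF i(1)] by blast
  qed
  then have "2 * card (f ` I) + 2 \<le> card (C \<union> I)"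
    using big fC by (intro HIST_degree_3_bound[OF T]) auto
  ultimately show False
    using card_C fin disj by (simp add: card_image card_Un_disjoint)
qed

text \<open>The private leaves force degree at least 3 in \<open>T\<close> at every vertex of
  \<open>C\<close>, so \<open>2 * card C + 2 <= card C + card I\<close>. But \<open>I\<close>
  consists of the private leaves and at most one further vertex, so
  \<open>card I <= card C + 1\<close>.\<close>

lemma pendant_star_no_HIST:
  assumes split: "split_graph C I E" and conn: "connected_graph (C \<union> I) E"
    and big: "card (C \<union> I) \<ge> 3" and star: "pendant_star C I E"
  shows "\<not> HIST (C \<union> I) E T"
proof
  assume T: "HIST (C \<union> I) E T"
  have fin: "finite C" "finite I" and disj: "C \<inter> I = {}"
    using split by (auto simp: split_graph_def simple_graph_def)
  have TE: "T \<subseteq> E" and connT: "connected_graph (C \<union> I) T"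
    using T by (auto simp: HIST_def spanning_tree_def tree_def)
  have simpleT: "simple_graph (C \<union> I) T"
    using connT by (simp add: connected_graph_def)
  define U where "U = {u \<in> C. card (neighbours E u \<inter> I) = 2}"
  have U: "card U \<ge> 2" "inj_on (\<lambda>u. neighbours E u \<inter> I) U"
    "\<And>u. u \<in> C - U \<Longrightarrow> \<exists>v. neighbours E u \<inter> I = {v} \<and> pendant E v"
    "card (\<Inter>u\<in>U. neighbours E u \<inter> I) = 1"
    using star by (auto simp: pendant_star_def Let_def U_def)
  have UC: "U \<subseteq> C"
    by (auto simp: U_def)
  obtain w where w: "(\<Inter>u\<in>U. neighbours E u \<inter> I) = {w}"
    using U(4) by (auto simp: card_1_singleton_iff)
  obtain x y where xy: "x \<in> U" "y \<in> U" "x \<noteq> y"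
    using U(1) by (auto simp: numeral_2_eq_2 card_le_Suc_iff)
  have w_in: "w \<in> neighbours E u \<inter> I" if "u \<in> U" for u
    using w that by blast
  have pair: "\<exists>b. b \<noteq> w \<and> neighbours E u \<inter> I = {w, b}" if "u \<in> U" for u
  proof -
    have "card (neighbours E u \<inter> I) = 2"
      using that by (simp add: U_def)
    then obtain p q where "neighbours E u \<inter> I = {p, q}" "p \<noteq> q"
      unfolding card_2_iff by blast
    then show ?thesis
      using w_in[OF that] by auto
  qed
  have pendant_unique: "u = u'" if "pendant E i" "u \<in> neighbours E i" "u' \<in> neighbours E i" for u u' i
    using that unfolding pendant_def vertex_degree_def by (metis card_1_singletonE singletonD)
  \<comment> \<open>Here \<open>b\<close> is the private leaf of \<open>u\<close>. The inclusion in
    \<open>{w, b}\<close> covers both the vertices of \<open>U\<close>, which are also adjacent to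
    \<open>w\<close>, and the others, for which \<open>b\<close> is the only neighbour in
    \<open>I\<close>.\<close>
  have key: "\<exists>b. neighbours E u \<inter> I \<subseteq> {w, b} \<and> b \<in> neighbours E u \<inter> I \<and> neighbours E b = {u}"
    if u: "u \<in> C" for u
  proof (cases "u \<in> U")
    case True
    then obtain b where b: "b \<noteq> w" "neighbours E u \<inter> I = {w, b}"
      using pair by blast
    \<comment> \<open>A second neighbour of \<open>b\<close> inside \<open>U\<close> would have the
      same pair \<open>{w, b}\<close>, against injectivity; one outside \<open>U\<close> would make
      \<open>b\<close> pendant.\<close>
    have "u' = u" if "u' \<in> neighbours E b" for u'
    proof -
      have bI: "b \<in> I" and ub: "u \<in> neighbours E b"
        using b(2) neighbours_sym[of b E u] by auto
      have b': "b \<in> neighbours E u' \<inter> I"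
        using that neighbours_sym[of b E u'] bI by auto
      have "u' \<in> C"
        using split_graph_neighbours_subset[OF split bI] that by blast
      show "u' = u"
      proof (cases "u' \<in> U")
        case True
        then have "neighbours E u' \<inter> I = neighbours E u \<inter> I"
          using pair[OF True] b b' by auto
        then show ?thesis
          using U(2) True \<open>u \<in> U\<close> by (auto dest: inj_onD)
      next
        case False
        then obtain k where "neighbours E u' \<inter> I = {k}" "pendant E k"
          using U(3)[of u'] \<open>u' \<in> C\<close> by blast
        then have "pendant E b"
          using b' by simp
        then show ?thesis
          using pendant_unique that ub by blast
      qed
    qed
    moreover have "u \<in> neighbours E b"
      using b(2) neighbours_sym[of b E u] by auto
    ultimately have "neighbours E b = {u}"
      by blast
    then show ?thesis
      using b by blast
  next
    case False
    then obtain b where b: "neighbours E u \<inter> I = {b}" "pendant E b"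
      using U(3)[of u] u by blast
    then have "u \<in> neighbours E b"
      using neighbours_sym[of b E u] by auto
    then have "neighbours E b = {u}"
      using pendant_unique[OF b(2)] by blast
    then show ?thesis
      using b(1) by (intro exI[of _ b]) simp
  qed
  then obtain b where b: "\<And>u. u \<in> C \<Longrightarrow> neighbours E u \<inter> I \<subseteq> {w, b u}"
    "\<And>u. u \<in> C \<Longrightarrow> b u \<in> I" "\<And>u. u \<in> C \<Longrightarrow> neighbours E (b u) = {u}"
    by (metis IntD2)
  have "I \<subseteq> insert w (b ` C)"
  proof
    fix i assume i: "i \<in> I"
    have "vertex_degree E i \<ge> 1"
      using connected_graph_vertex_degree_pos[OF conn, of i x] i xy UC disj by blast
    then obtain u where u: "u \<in> neighbours E i"
      by (fastforce simp: vertex_degree_def)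
    then have "u \<in> C"
      using split_graph_neighbours_subset[OF split i] by blast
    moreover have "i \<in> neighbours E u"
      using u neighbours_sym[of i E u] by simp
    ultimately show "i \<in> insert w (b ` C)"
      using b(1) i by blast
  qed
  then have "card I \<le> card (insert w (b ` C))"
    using fin by (intro card_mono) auto
  also have "\<dots> \<le> card (b ` C) + 1"
    using fin by (simp add: card_insert_if)
  also have "\<dots> \<le> card C + 1"
    using card_image_le[OF fin(1), of b] by simp
  finally have card_I: "card I \<le> card C + 1" .
  have "vertex_degree T u \<ge> 3" if u: "u \<in> C" for u
  proof -
    have "b u \<noteq> u"
      using b(2)[OF u] u disj by (metis disjoint_iff)
    then have "vertex_degree T (b u) \<ge> 1"
      using b(2)[OF u] u by (intro connected_graph_vertex_degree_pos[OF connT, of _ u]) simp_all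
    moreover have "neighbours T (b u) \<subseteq> {u}"
      using neighbours_mono[OF TE, of "b u"] b(3)[OF u] by simp
    ultimately have "neighbours T (b u) = {u}"
      by (auto simp: vertex_degree_def subset_singleton_iff)
    then have "{u, b u} \<in> T" "vertex_degree T (b u) = 1"
      using neighbours_iff[of u T "b u"] by (simp_all add: vertex_degree_def insert_commute)
    then show ?thesis
      using HIST_leaf_neighbour[OF T big] by blast
  qed
  then have "2 * card C + 2 \<le> card (C \<union> I)"
    using big by (intro HIST_degree_3_bound[OF T]) auto
  then show False
    using card_I fin disj by (simp add: card_Un_disjoint)
qed

theorem theorem4:
  fixes C I :: "'a set" and E :: "'a set set"
  assumes "split_graph C I E"
    and "connected_graph (C \<union> I) E"
    and "\<exists>v\<in>I. vertex_degree E v \<ge> 2"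
  shows "(\<nexists>T. HIST (C \<union> I) E T) \<longleftrightarrow>
    ((\<forall>u\<in>C. card (neighbours E u \<inter> I) = 1) \<and> int (card C) - int (card I) = 1)
    \<or> (let U = {u \<in> C. card (neighbours E u \<inter> I) = 2} in
         (\<forall>u\<in>C. card (neighbours E u \<inter> I) \<in> {1, 2}) \<and> card U \<ge> 2
       \<and> inj_on (\<lambda>u. neighbours E u \<inter> I) U
       \<and> (\<forall>u\<in>C - U. \<exists>v. neighbours E u \<inter> I = {v} \<and> pendant E v)
       \<and> card (\<Inter>u\<in>U. neighbours E u \<inter> I) = 1)"
  unfolding perfectly_pendant_def[symmetric] pendant_star_def[symmetric]
proof -
  obtain v where v: "v \<in> I" "vertex_degree E v \<ge> 2"
    using assms(3) by blast
  have fin: "finite (C \<union> I)" and disj: "C \<inter> I = {}" and simple: "simple_graph (C \<union> I) E"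
    using assms(1) by (auto simp: split_graph_def simple_graph_def)
  have "neighbours E v \<subseteq> C"
    using split_graph_neighbours_subset[OF assms(1) v(1)] .
  \<comment> \<open>The vertex \<open>v\<close> and its two or more neighbours are at least three
    vertices, as needed to keep two leaves of a HIST from being adjacent.\<close>
  then have "card (insert v (neighbours E v)) \<le> card (C \<union> I)" "v \<notin> neighbours E v"
    using v(1) disj fin by (auto intro: card_mono)
  then have big: "card (C \<union> I) \<ge> 3"
    using v(2) finite_neighbours[OF simple, of v] by (simp add: vertex_degree_def)
  show "(\<nexists>T. HIST (C \<union> I) E T) \<longleftrightarrow> perfectly_pendant C I E \<or> pendant_star C I E"
    using no_HIST_imp_exceptional[OF assms(1,2) v] perfectly_pendant_no_HIST[OF assms(1) big]
      pendant_star_no_HIST[OF assms(1,2) big] by blast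
qed

end
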